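(* Let $A \in \mathbb{Z}^{m \times n}$ be an integer matrix with columns $a_1,\dots,a_n$ such that $\mathbf{1} \in \operatorname{rowspan}(A)$, and let $\mathcal{M} = \{p \in \Delta_{n-1} : \log(p) \in \operatorname{rowspan}(A)\}$ be the associated toric (log-linear) model. Then for every $p \in \mathcal{M}$ the logarithmic Voronoi cell of $p$ is the preimage $\phi_A^{-1}(\mu_A(p))$ intersected with $\Delta_{n-1}$: $$\log \mathrm{Vor}_{\mathcal{M}}(p) = \phi_A^{-1}(\mu_A(p)) \cap \Delta_{n-1}.$$ Thus $\phi_A|_{\Delta_{n-1}}$ is a map whose image is a polytope and whose fibres are also polytopes (up to boundary points: the image is the relative interior of a polytope, and each fibre is the intersection of a polytope with the open simplex $\Delta_{n-1}$).
   Context: $\Delta_{n-1} = \{u \in \mathbb{R}^n : \sum_{i=1}^n u_i = 1,\ u_i > 0 \text{ for all } i\}$ is the open probability simplex; it is identified with a subset of $\mathbb{P}_{\mathbb{C}}^{n-1}$ via $\Delta_{n-1} \subset \mathbb{C}^n\setminus\{0\} \to \mathbb{P}_{\mathbb{C}}^{n-1}$. $\log(p) = (\log p_1,\dots,\log p_n)$. Define $$\phi_A : \mathbb{P}_{\mathbb{C}}^{n-1} \to \mathbb{R}^m, \qquad z \mapsto \frac{1}{\sum_{i=1}^n |z_i|} \sum_{i=1}^n |z_i| a_i .$$ The algebraic moment map $\mu_A$ is the restriction of $\phi_A$ to the projective toric variety $\mathcal{M}_A \subset \mathbb{P}_{\mathbb{C}}^{n-1}$ associated to $A$ (the Zariski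 closure of the image of the monomial parametrization given by the columns of $A$), which contains $\mathcal{M}$. For $u \in \Delta_{n-1}$ let $\ell_u(q) = \sum_{i=1}^n u_i \log(q_i)$. Write $\Phi(u)=p$ if $p \in \mathcal{M}$ and $p \in \operatorname{argmax}_{q \in \mathcal{M}} \ell_u(q)$. The logarithmic Voronoi cell of $p \in \mathcal{M}$ is $\log \mathrm{Vor}_{\mathcal{M}}(p) = \{u \in \Delta_{n-1} : \Phi(u) = p\}$. *)

theory Defs
  imports "HOL-Analysis.Analysis" "HOL-Library.Poly_Mapping"
begin

text \<open>Points are nonzero complex vectors up to a complex scalar. The quotient is partial, so
  \<open>abs_cproj z\<close> is meaningful only for \<open>z \<noteq> 0\<close>.\<close>

definition proj_equiv :: "complex^'n \<Rightarrow> complex^'n \<Rightarrow> bool" where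
  "proj_equiv z w \<longleftrightarrow> z \<noteq> 0 \<and> w \<noteq> 0 \<and> (\<exists>c. w = c *s z)"

lemma part_equivp_proj_equiv: "part_equivp (proj_equiv :: complex^'n \<Rightarrow> _)"
proof (rule part_equivpI)
  have "proj_equiv (1 :: complex^'n) 1"
    unfolding proj_equiv_def by (auto intro!: exI[of _ 1])
  then show "\<exists>z :: complex^'n. proj_equiv z z" ..
  show "symp (proj_equiv :: complex^'n \<Rightarrow> _)"
  proof (rule sympI)
    fix z w :: "complex^'n"
    assume "proj_equiv z w"
    then obtain c where c: "z \<noteq> 0" "w \<noteq> 0" "w = c *s z"
      by (auto simp: proj_equiv_def)
    then have "c \<noteq> 0" by auto
    then have "z = inverse c *s w" using c(3) by simp
    with c(1,2) show "proj_equiv w z" by (auto simp: proj_equiv_def)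
  qed
  show "transp (proj_equiv :: complex^'n \<Rightarrow> _)"
    by (rule transpI) (auto simp: proj_equiv_def)
qed

quotient_type (overloaded) 'n cproj = "complex^('n::finite)" / partial: proj_equiv
  by (rule part_equivp_proj_equiv)

definition poly_eval :: "(('n \<Rightarrow>\<^sub>0 nat) \<Rightarrow>\<^sub>0 complex) \<Rightarrow> complex^'n \<Rightarrow> complex" where
  "poly_eval f z =
     (\<Sum>\<alpha>\<in>Poly_Mapping.keys f. Poly_Mapping.lookup f \<alpha> * (\<Prod>i\<in>UNIV. (z $ i) ^ Poly_Mapping.lookup \<alpha> i))"

definition homogeneous_poly :: "(('n::finite \<Rightarrow>\<^sub>0 nat) \<Rightarrow>\<^sub>0 complex) \<Rightarrow> bool" where
  "homogeneous_poly f \<longleftrightarrow>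
     (\<exists>d. \<forall>\<alpha>\<in>Poly_Mapping.keys f. (\<Sum>i\<in>UNIV. Poly_Mapping.lookup \<alpha> i) = d)"

definition proj_zero_set :: "(('n::finite \<Rightarrow>\<^sub>0 nat) \<Rightarrow>\<^sub>0 complex) set \<Rightarrow> 'n cproj set" where
  "proj_zero_set F = {x. \<forall>f\<in>F. \<forall>z. z \<noteq> 0 \<and> abs_cproj z = x \<longrightarrow> poly_eval f z = 0}"

definition zariski_closed :: "'n::finite cproj set \<Rightarrow> bool" where
  "zariski_closed V \<longleftrightarrow> (\<exists>F. (\<forall>f\<in>F. homogeneous_poly f) \<and> V = proj_zero_set F)"

definition zariski_closure :: "'n::finite cproj set \<Rightarrow> 'n cproj set" where
  "zariski_closure S = zariski_closed hull S"

text \<open>The \<open>j\<close>-th homogeneous coordinate is the Laurent monomial \<open>\<theta>\<close> to the power \<open>column j A\<close>.\<close>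

definition monomial_param :: "int^'n^'m \<Rightarrow> complex^'m \<Rightarrow> 'n::finite cproj" where
  "monomial_param A \<theta> = abs_cproj (\<chi> j. \<Prod>i\<in>UNIV. (\<theta> $ i) powi (A $ i $ j))"

definition toric_variety :: "int^'n^'m \<Rightarrow> 'n::finite cproj set" where
  "toric_variety A = zariski_closure (monomial_param A ` {\<theta>. \<forall>i. \<theta> $ i \<noteq> 0})"

abbreviation real_matrix :: "int^'n^'m \<Rightarrow> real^'n^'m" where
  "real_matrix \<equiv> map_matrix real_of_int"

lift_definition phi :: "int^'n^'m \<Rightarrow> 'n::finite cproj \<Rightarrow> real^'m" is
  "\<lambda>A z. (1 / (\<Sum>i\<in>UNIV. cmod (z $ i))) *\<^sub>R
           (\<Sum>i\<in>UNIV. cmod (z $ i) *\<^sub>R column i (real_matrix A))"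
proof -
  fix A :: "int^'n^'m" and z w :: "complex^'n"
  assume "proj_equiv z w"
  then obtain c where c: "z \<noteq> 0" "w \<noteq> 0" "w = c *s z"
    by (auto simp: proj_equiv_def)
  then have "c \<noteq> 0" by auto
  then show "(1 / (\<Sum>i\<in>UNIV. cmod (z $ i))) *\<^sub>R
        (\<Sum>i\<in>UNIV. cmod (z $ i) *\<^sub>R column i (real_matrix A)) =
      (1 / (\<Sum>i\<in>UNIV. cmod (w $ i))) *\<^sub>R
        (\<Sum>i\<in>UNIV. cmod (w $ i) *\<^sub>R column i (real_matrix A))"
    by (simp add: c(3) norm_mult scaleR_sum_right flip: sum_distrib_left)
qed

text \<open>As \<open>moment_map A\<close> is undefined off the toric variety, it agrees with \<open>phi A\<close> at a point of
  the log-linear model only because that model lies on the variety.\<close>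

definition moment_map :: "int^'n^'m \<Rightarrow> 'n::finite cproj \<Rightarrow> real^'m" where
  "moment_map A = restrict (phi A) (toric_variety A)"

definition prob_simplex :: "(real^'n) set" where
  "prob_simplex = {u. (\<Sum>i\<in>UNIV. u $ i) = 1 \<and> (\<forall>i. u $ i > 0)}"

definition to_proj :: "real^'n \<Rightarrow> 'n::finite cproj" where
  "to_proj u = abs_cproj (\<chi> i. complex_of_real (u $ i))"

definition rowspan :: "int^'n^'m \<Rightarrow> (real^'n) set" where
  "rowspan A = span (rows (real_matrix A))"

definition toric_model :: "int^'n^'m \<Rightarrow> (real^'n) set" where
  "toric_model A = {p \<in> prob_simplex. (\<chi> i. ln (p $ i)) \<in> rowspan A}"

definition log_likelihood :: "real^'n \<Rightarrow> real^'n \<Rightarrow> real" where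
  "log_likelihood u q = (\<Sum>i\<in>UNIV. u $ i * ln (q $ i))"

text \<open>\<open>is_MLE M u p\<close> renders \<open>\<Phi>(u) = p\<close>. It is a relation because existence and uniqueness of the
  maximizer are not part of the definition.\<close>

definition is_MLE :: "(real^'n) set \<Rightarrow> real^'n \<Rightarrow> real^'n \<Rightarrow> bool" where
  "is_MLE M u p \<longleftrightarrow> is_arg_max (log_likelihood u) (\<lambda>q. q \<in> M) p"

definition log_Vor :: "(real^'n) set \<Rightarrow> real^'n \<Rightarrow> (real^'n) set" where
  "log_Vor M p = {u \<in> prob_simplex. is_MLE M u p}"

end

theory Submission
  imports Defs
begin

text \<open>
  On the open simplex the coordinates are positive and sum to one, so there \<open>phi A\<close> is nothing
  but the linear map \<open>u \<mapsto> A u\<close> (\<open>phi_to_proj\<close>). All three assertions are read off from this.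

  \<^bold>\<open>Voronoi cells.\<close> They are cut out by the likelihood equations: a point \<open>p\<close> of the model maximizes
  the likelihood of \<open>u\<close> iff \<open>A u = A p\<close> (\<open>is_MLE_iff\<close>). If the equation holds, then \<open>u - p\<close> is
  orthogonal to the row space, hence to \<open>log q\<close> for every \<open>q\<close> in the model. So \<open>u\<close> and \<open>p\<close> have
  the same likelihood function on the model, and that of \<open>p\<close> is maximal at \<open>p\<close> by Gibbs'
  inequality. Conversely, for \<open>v\<close> in the row space the exponential family
  \<open>p\<^sub>j exp (s v\<^sub>j) / Z s\<close> is a curve through \<open>p\<close>, which stays in the model because the vector of
  ones lies in the row space and so pays for the normalization. The derivative at \<open>s = 0\<close> of the
  log-likelihood along it is \<open>u \<bullet> v - p \<bullet> v\<close>, which must vanish at a maximum; letting \<open>v\<close> run over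
  the rows of \<open>A\<close> gives \<open>A u = A p\<close>. The moment map takes the value \<open>A p\<close> at \<open>p\<close> because \<open>p\<close>
  lies on the toric variety (\<open>to_proj_toric_model\<close>).

  \<^bold>\<open>Image and fibres.\<close> The open simplex is the relative interior of the closed simplex
  (\<open>prob_simplex_eq_rel_interior\<close>), and linear maps commute with relative interiors of convex sets,
  so the image is the relative interior of the convex hull of the columns of \<open>A\<close>. A fibre is the
  trace on the open simplex of the closed simplex cut by the affine subspace \<open>A u = y\<close>.
\<close>

section \<open>The open simplex\<close>

lemma sum_Basis_vec:
  "(\<Sum>b\<in>(Basis :: (real^'n) set). f b) = (\<Sum>i\<in>UNIV. f (axis i 1))"
proof -
  have "(Basis :: (real^'n) set) = range (\<lambda>i. axis i 1)"
    by (auto simp: Basis_vec_def)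
  then have "(\<Sum>b\<in>Basis. f b) = sum f (range (\<lambda>i::'n. axis i 1))"
    by (rule arg_cong)
  also have "\<dots> = sum (f \<circ> (\<lambda>i. axis i 1)) UNIV"
    by (rule sum.reindex) (auto simp: inj_on_def axis_eq_axis)
  finally show ?thesis
    by (simp add: o_def)
qed

text \<open>The basis vectors are affinely independent, so the relative interior of their hull consists
  of the combinations with positive weights, and these weights are the coordinates of the point.\<close>

lemma prob_simplex_eq_rel_interior:
  "(prob_simplex :: (real^'n) set) = rel_interior (convex hull Basis)"
proof -
  have "\<not> affine_dependent (Basis :: (real^'n) set)"
    using affine_dependent_imp_dependent independent_Basis by blast
  then have ri: "rel_interior (convex hull (Basis :: (real^'n) set)) =
      {y. \<exists>c. (\<forall>b\<in>Basis. 0 < c b) \<and> sum c Basis = 1 \<and> (\<Sum>b\<in>Basis. c b *\<^sub>R b) = y}"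
    by (rule rel_interior_convex_hull_explicit)
  have "u \<in> prob_simplex \<longleftrightarrow> u \<in> rel_interior (convex hull Basis)" for u :: "real^'n"
  proof
    assume u: "u \<in> prob_simplex"
    have "\<forall>b\<in>Basis. 0 < u \<bullet> b"
      using u by (auto simp: prob_simplex_def Basis_vec_def inner_axis)
    moreover have "(\<Sum>b\<in>Basis. u \<bullet> b) = 1"
      using u by (simp add: prob_simplex_def sum_Basis_vec inner_axis)
    moreover have "(\<Sum>b\<in>Basis. (u \<bullet> b) *\<^sub>R b) = u"
      by (rule euclidean_representation)
    ultimately show "u \<in> rel_interior (convex hull Basis)"
      unfolding ri by blast
  next
    assume "u \<in> rel_interior (convex hull Basis)"
    then obtain c where c: "\<forall>b\<in>Basis. 0 < c b" "sum c Basis = 1" "(\<Sum>b\<in>Basis. c b *\<^sub>R b) = u"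
      unfolding ri by blast
    have "u $ i = c (axis i 1)" for i
    proof -
      have "u \<bullet> axis i 1 = c (axis i 1)"
        unfolding c(3)[symmetric] by (rule inner_sum_left_Basis) (simp add: axis_in_Basis_iff)
      then show ?thesis
        by (simp add: inner_axis)
    qed
    with c(1,2) show "u \<in> prob_simplex"
      by (auto simp: prob_simplex_def sum_Basis_vec axis_in_Basis_iff)
  qed
  then show ?thesis
    by blast
qed

section \<open>The map \<open>phi\<close> on the simplex and the model on the toric variety\<close>

lemma proj_equiv_self: "proj_equiv z z \<longleftrightarrow> z \<noteq> 0"
  by (auto simp: proj_equiv_def intro: exI[of _ 1])

text \<open>The absolute values and the normalizing denominator in \<open>phi\<close> disappear for a probability
  vector, which leaves the combination of the columns that defines \<open>A *v u\<close>.\<close>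

lemma phi_to_proj:
  fixes A :: "int^'n^'m"
  assumes "u \<in> prob_simplex"
  shows "phi A (to_proj u) = real_matrix A *v u"
proof -
  let ?z = "\<chi> i. complex_of_real (u $ i)"
  have sum1: "(\<Sum>i\<in>UNIV. u $ i) = 1" and pos: "\<And>i. u $ i > 0"
    using assms by (auto simp: prob_simplex_def)
  have "?z \<noteq> 0"
    using pos by (simp add: vec_eq_iff less_imp_neq[THEN not_sym])
  then have "phi A (to_proj u) =
      (1 / (\<Sum>i\<in>UNIV. cmod (?z $ i))) *\<^sub>R
        (\<Sum>i\<in>UNIV. cmod (?z $ i) *\<^sub>R column i (real_matrix A))"
    unfolding to_proj_def by (intro phi.abs_eq) (simp add: proj_equiv_self)
  also have "\<dots> = real_matrix A *v u"
    using sum1 by (simp add: abs_of_pos pos matrix_mult_sum scalar_mult_eq_scaleR)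
  finally show ?thesis .
qed

text \<open>A point of the row space comes with coefficients \<open>t\<close>; their exponentials will be the
  parameters of the corresponding point of the torus.\<close>

lemma rowspan_eq_range: "rowspan A = range (\<lambda>t. transpose (real_matrix A) *v t)"
proof
  have "rows (real_matrix A) \<subseteq> range (\<lambda>t. transpose (real_matrix A) *v t)"
  proof
    fix r assume "r \<in> rows (real_matrix A)"
    then obtain i where "r = row i (real_matrix A)"
      by (auto simp: rows_def)
    then have "r = transpose (real_matrix A) *v axis i 1"
      by (simp add: matrix_vector_mult_basis)
    then show "r \<in> range (\<lambda>t. transpose (real_matrix A) *v t)"
      by blast
  qed
  then show "rowspan A \<subseteq> range (\<lambda>t. transpose (real_matrix A) *v t)"
    unfolding rowspan_def
    by (intro span_minimal linear_subspace_image subspace_UNIV matrix_vector_mul_linear)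
next
  show "range (\<lambda>t. transpose (real_matrix A) *v t) \<subseteq> rowspan A"
    using matrix_vector_mult_in_columnspace[of "transpose (real_matrix A)"]
    by (auto simp: rowspan_def columns_transpose)
qed

text \<open>Exponentiating \<open>log p = A\<^sup>T t\<close> turns the linear combination of the rows into the Laurent
  monomials at \<open>\<theta> = exp t\<close>. So a point of the model is the value of the monomial parametrization
  at a positive real point of the torus, and the variety contains all such values.\<close>

lemma to_proj_toric_model:
  fixes A :: "int^'n^'m"
  assumes "p \<in> toric_model A"
  shows "to_proj p \<in> toric_variety A"
proof -
  from assms obtain t where t: "(\<chi> j. ln (p $ j)) = transpose (real_matrix A) *v t"
    by (auto simp: toric_model_def rowspan_eq_range)
  define \<theta> :: "complex^'m" where "\<theta> = (\<chi> i. of_real (exp (t $ i)))"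
  have "(\<Prod>i\<in>UNIV. (\<theta> $ i) powi (A $ i $ j)) = of_real (p $ j)" for j
  proof -
    have "p $ j > 0"
      using assms by (auto simp: toric_model_def prob_simplex_def)
    moreover have "ln (p $ j) = (\<Sum>i\<in>UNIV. real_of_int (A $ i $ j) * t $ i)"
      using arg_cong[OF t, of "\<lambda>x. x $ j"]
      by (simp add: matrix_vector_mult_def transpose_def map_matrix_def)
    ultimately have "p $ j = (\<Prod>i\<in>UNIV. exp (real_of_int (A $ i $ j) * t $ i))"
      by (metis exp_ln exp_sum finite)
    also have "\<dots> = (\<Prod>i\<in>UNIV. exp (t $ i) powi (A $ i $ j))"
      by (simp add: exp_power_int mult.commute)
    finally show ?thesis
      by (simp add: \<theta>_def)
  qed
  then have "to_proj p = monomial_param A \<theta>"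
    by (simp add: to_proj_def monomial_param_def)
  moreover have "\<forall>i. \<theta> $ i \<noteq> 0"
    by (simp add: \<theta>_def)
  ultimately show ?thesis
    unfolding toric_variety_def zariski_closure_def
    by (intro hull_inc) blast
qed

section \<open>The likelihood equations\<close>

lemma log_likelihood_inner: "log_likelihood u q = u \<bullet> (\<chi> i. ln (q $ i))"
  by (simp add: log_likelihood_def inner_vec_def)

text \<open>The bound \<open>ln x \<le> x - 1\<close> at \<open>x = q\<^sub>i / p\<^sub>i\<close>, averaged with the weights \<open>p\<^sub>i\<close>, has a
  right-hand side that sums to zero.\<close>

lemma gibbs_inequality:
  assumes "p \<in> prob_simplex" "q \<in> prob_simplex"
  shows "log_likelihood p q \<le> log_likelihood p p"
proof -
  have p: "\<And>i. p $ i > 0" and q: "\<And>i. q $ i > 0"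
    using assms by (auto simp: prob_simplex_def)
  have "log_likelihood p q - log_likelihood p p = (\<Sum>i\<in>UNIV. p $ i * ln (q $ i / p $ i))"
    by (simp add: log_likelihood_def ln_div p q less_imp_neq[THEN not_sym] algebra_simps
        flip: sum_subtractf)
  also have "\<dots> \<le> (\<Sum>i\<in>UNIV. p $ i * (q $ i / p $ i - 1))"
    by (intro sum_mono mult_left_mono ln_le_minus_one) (simp_all add: p q less_imp_le)
  also have "\<dots> = (\<Sum>i\<in>UNIV. q $ i - p $ i)"
    using p by (intro sum.cong) (auto simp: field_simps less_imp_neq[THEN not_sym])
  also have "\<dots> = 0"
    using assms by (simp add: prob_simplex_def sum_subtractf)
  finally show ?thesis
    by simp
qed

definition partition_function :: "real^'n \<Rightarrow> real^'n \<Rightarrow> real \<Rightarrow> real" where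
  "partition_function p v s = (\<Sum>j\<in>UNIV. p $ j * exp (s * v $ j))"

text \<open>The exponential family through \<open>p\<close> with sufficient statistic \<open>v\<close> and parameter \<open>s\<close>.\<close>

definition exponential_tilt :: "real^'n \<Rightarrow> real^'n \<Rightarrow> real \<Rightarrow> real^'n" where
  "exponential_tilt p v s = (\<chi> j. p $ j * exp (s * v $ j) / partition_function p v s)"

lemma partition_function_pos:
  assumes "p \<in> prob_simplex"
  shows "partition_function p v s > 0"
  using assms unfolding partition_function_def prob_simplex_def by (intro sum_pos) auto

lemma exponential_tilt_in_prob_simplex:
  assumes "p \<in> prob_simplex"
  shows "exponential_tilt p v s \<in> prob_simplex"
  using assms partition_function_pos[OF assms, of v s]
  by (auto simp: prob_simplex_def exponential_tilt_def partition_function_def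
      simp flip: sum_divide_distrib)

text \<open>In logarithmic coordinates a tilt is a translation by \<open>s v\<close>, up to a multiple of the vector of
  ones. This accounts both for tilts staying in the model and for the simple form of the
  likelihood along them.\<close>

lemma ln_exponential_tilt:
  assumes "p \<in> prob_simplex"
  shows "(\<chi> j. ln (exponential_tilt p v s $ j)) =
    (\<chi> j. ln (p $ j)) + s *\<^sub>R v - ln (partition_function p v s) *\<^sub>R (\<chi> j. 1)"
proof -
  have "p $ j > 0" for j
    using assms by (auto simp: prob_simplex_def)
  then show ?thesis
    using partition_function_pos[OF assms, of v s]
    by (simp add: vec_eq_iff exponential_tilt_def ln_div ln_mult less_imp_neq[THEN not_sym])
qed

lemma exponential_tilt_in_toric_model:
  assumes one: "(\<chi> i. 1) \<in> rowspan A" and p: "p \<in> toric_model A" and v: "v \<in> rowspan A"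
  shows "exponential_tilt p v s \<in> toric_model A"
proof -
  have ps: "p \<in> prob_simplex" and lp: "(\<chi> j. ln (p $ j)) \<in> rowspan A"
    using p by (auto simp: toric_model_def)
  have "(\<chi> j. ln (exponential_tilt p v s $ j)) \<in> rowspan A"
    using one lp v unfolding ln_exponential_tilt[OF ps] rowspan_def
    by (intro span_add span_diff span_scale)
  with ps show ?thesis
    by (simp add: toric_model_def exponential_tilt_in_prob_simplex)
qed

text \<open>These are the likelihood equations, obtained as the critical equation at \<open>s = 0\<close> along the
  tilt in the direction \<open>v\<close>: the derivative of \<open>ln Z\<close> at 0 is the mean of \<open>v\<close> under \<open>p\<close>.\<close>

lemma MLE_inner_eq:
  assumes one: "(\<chi> i. 1) \<in> rowspan A" and p: "p \<in> toric_model A" and u: "u \<in> prob_simplex"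
    and mle: "is_MLE (toric_model A) u p" and v: "v \<in> rowspan A"
  shows "u \<bullet> v = p \<bullet> v"
proof -
  have ps: "p \<in> prob_simplex"
    using p by (simp add: toric_model_def)
  have Z0: "partition_function p v 0 = 1"
    using ps by (simp add: partition_function_def prob_simplex_def)
  have u1: "u \<bullet> (\<chi> j. 1) = 1"
    using u by (simp add: prob_simplex_def inner_vec_def)
  let ?f = "\<lambda>s. log_likelihood u (exponential_tilt p v s)"
  have f: "?f s = log_likelihood u p + s * (u \<bullet> v) - ln (partition_function p v s)" for s
    by (simp add: log_likelihood_inner ln_exponential_tilt[OF ps] inner_add_right inner_diff_right u1)
  have "(partition_function p v has_real_derivative (\<Sum>j\<in>UNIV. p $ j * v $ j)) (at 0)"
    unfolding partition_function_def[abs_def]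
    by (auto intro!: derivative_eq_intros sum.cong)
  then have "(?f has_real_derivative (u \<bullet> v - p \<bullet> v)) (at 0)"
    unfolding f using Z0 by (auto intro!: derivative_eq_intros simp: inner_vec_def)
  moreover have "?f s \<le> ?f 0" for s
  proof -
    have "?f s \<le> log_likelihood u p"
      using mle exponential_tilt_in_toric_model[OF one p v, of s]
      by (auto simp: is_MLE_def is_arg_max_def not_less)
    also have "\<dots> = ?f 0"
      unfolding f by (simp add: Z0)
    finally show ?thesis .
  qed
  ultimately have "u \<bullet> v - p \<bullet> v = 0"
    by (intro DERIV_local_max[of ?f _ 0 1]) auto
  then show ?thesis
    by simp
qed

text \<open>The forward direction applies the likelihood equations to the rows of \<open>A\<close>. For the backward
  direction, the kernel of \<open>A\<close> is orthogonal to its row space, so that \<open>u\<close> may be replaced by \<open>p\<close>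
  in the likelihood of any point of the model.\<close>

lemma is_MLE_iff:
  fixes A :: "int^'n^'m"
  assumes one: "(\<chi> i. 1) \<in> rowspan A" and p: "p \<in> toric_model A" and u: "u \<in> prob_simplex"
  shows "is_MLE (toric_model A) u p \<longleftrightarrow> real_matrix A *v u = real_matrix A *v p"
proof
  assume mle: "is_MLE (toric_model A) u p"
  have "(real_matrix A *v u) $ i = (real_matrix A *v p) $ i" for i
  proof -
    have "row i (real_matrix A) \<in> rowspan A"
      unfolding rowspan_def by (rule span_base) (auto simp: rows_def)
    from MLE_inner_eq[OF one p u mle this] show ?thesis
      by (simp only: matrix_vector_mul_component row_def vec_nth_inverse inner_commute)
  qed
  then show "real_matrix A *v u = real_matrix A *v p"
    by (simp add: vec_eq_iff)
next
  assume "real_matrix A *v u = real_matrix A *v p"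
  then have "real_matrix A *v (u - p) = 0"
    by (simp add: matrix_vector_mult_diff_distrib)
  then have eq: "log_likelihood u q = log_likelihood p q" if "q \<in> toric_model A" for q
    using orthogonal_nullspace_rowspace[of "real_matrix A" "u - p" "\<chi> i. ln (q $ i)"] that
    by (simp add: toric_model_def rowspan_def orthogonal_def log_likelihood_inner inner_diff_left)
  have "log_likelihood u q \<le> log_likelihood u p" if "q \<in> toric_model A" for q
    using gibbs_inequality[of p q] p that by (simp add: eq) (simp add: toric_model_def)
  with p show "is_MLE (toric_model A) u p"
    by (auto simp: is_MLE_def is_arg_max_def not_less)
qed

section \<open>Logarithmic Voronoi cells, image and fibres\<close>

theorem corollary11:
  fixes A :: "int^'n^'m"
  assumes "(\<chi> i. 1) \<in> rowspan A"
  shows "(\<forall>p\<in>toric_model A.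
            log_Vor (toric_model A) p =
              to_proj -` (phi A -` {moment_map A (to_proj p)}) \<inter> prob_simplex) \<and>
         (\<exists>P. polytope P \<and> (\<lambda>u. phi A (to_proj u)) ` prob_simplex = rel_interior P) \<and>
         (\<forall>y. \<exists>Q. polytope Q \<and>
            {u \<in> prob_simplex. phi A (to_proj u) = y} = Q \<inter> prob_simplex)"
proof (intro conjI ballI allI)
  fix p assume p: "p \<in> toric_model A"
  then have "moment_map A (to_proj p) = real_matrix A *v p"
    by (simp add: moment_map_def to_proj_toric_model phi_to_proj toric_model_def)
  then show "log_Vor (toric_model A) p =
      to_proj -` (phi A -` {moment_map A (to_proj p)}) \<inter> prob_simplex"
    by (auto simp: log_Vor_def is_MLE_iff[OF assms p] phi_to_proj)
next
  let ?\<Delta> = "convex hull (Basis :: (real^'n) set)" and ?A = "\<lambda>u. real_matrix A *v u"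
  have \<Delta>: "polytope ?\<Delta>"
    by (simp add: polytope_convex_hull)
  have "(\<lambda>u. phi A (to_proj u)) ` prob_simplex = ?A ` prob_simplex"
    by (intro image_cong refl phi_to_proj)
  also have "\<dots> = rel_interior (?A ` ?\<Delta>)"
    unfolding prob_simplex_eq_rel_interior
    by (intro rel_interior_convex_linear_image matrix_vector_mul_linear convex_convex_hull)
  finally show "\<exists>P. polytope P \<and> (\<lambda>u. phi A (to_proj u)) ` prob_simplex = rel_interior P"
    using polytope_linear_image[OF matrix_vector_mul_linear \<Delta>] by blast
  fix y :: "real^'m"
  have "polyhedron (?A -` {y})"
    by (intro affine_imp_polyhedron)
      (auto simp: affine_def matrix_vector_right_distrib matrix_vector_mult_scaleR
        simp flip: scaleR_add_left)
  with \<Delta> have "polytope (?\<Delta> \<inter> ?A -` {y})"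
    by (rule polytope_Int_polyhedron)
  moreover have "prob_simplex \<subseteq> ?\<Delta>"
    unfolding prob_simplex_eq_rel_interior by (rule rel_interior_subset)
  then have "{u \<in> prob_simplex. phi A (to_proj u) = y} = (?\<Delta> \<inter> ?A -` {y}) \<inter> prob_simplex"
    by (auto simp: phi_to_proj)
  ultimately show "\<exists>Q. polytope Q \<and>
      {u \<in> prob_simplex. phi A (to_proj u) = y} = Q \<inter> prob_simplex"
    by blast
qed

end
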